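(* Let $n,\mu$ be integers with $1\le\mu\le n$, let $k$ be a real number with $0<k\le 1$, and let $P(z)=a_nz^n+\sum_{j=\mu}^{n}a_{n-j}z^{n-j}$ be a polynomial with complex coefficients, of degree $n$, having all its zeros in $|z|\le k$. Put $m=\min_{|z|=k}|P(z)|$ and $$A_\mu=\frac{n\left(|a_n|-\frac{m}{k^n}\right)k^{2\mu}+\mu|a_{n-\mu}|k^{\mu-1}}{n\left(|a_n|-\frac{m}{k^n}\right)k^{\mu-1}+\mu|a_{n-\mu}|}.$$ Then for every real or complex number $\alpha$ with $|\alpha|\ge k^\mu$, $$\max_{|z|=1}|D_\alpha P(z)|\ \ge\ \frac{n(|\alpha|-k^\mu)}{1+k^\mu}\max_{|z|=1}|P(z)|+\frac{n(|\alpha|+1)}{k^{n-\mu}(1+k^\mu)}\,m+n\left(\frac{k^\mu-A_\mu}{1+k^\mu}\right)\max_{|z|=1}|P(z)|+\frac{n(A_\mu-k^\mu)}{k^n(1+k^\mu)}\,m.$$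
   Context: For a polynomial $P$ of degree $n$ and $\alpha\in\mathbb{C}$, the polar derivative of $P$ with respect to $\alpha$ is $D_\alpha P(z)=nP(z)+(\alpha-z)P'(z)$. The form $P(z)=a_nz^n+\sum_{j=\mu}^{n}a_{n-j}z^{n-j}$ of degree $n$ means $a_n\neq 0$ and the coefficients of $z^{n-1},\dots,z^{n-\mu+1}$ vanish (no condition when $\mu=1$). *)

theory Defs
  imports "HOL-Analysis.Analysis" "HOL-Computational_Algebra.Polynomial"
begin

definition polar_deriv :: "complex \<Rightarrow> complex poly \<Rightarrow> complex poly" where
  "polar_deriv \<alpha> P = smult (of_nat (degree P)) P + [:\<alpha>, -1:] * pderiv P"

lemma poly_polar_deriv:
  "poly (polar_deriv \<alpha> P) z =
     of_nat (degree P) * poly P z + (\<alpha> - z) * poly (pderiv P) z"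
  by (simp add: polar_deriv_def algebra_simps)

text \<open>
  On a nonempty circle the supremum and the infimum below are attained, so they are the
  maximum and the minimum of the modulus; see the two lemmas that follow.
\<close>

definition max_modulus :: "complex poly \<Rightarrow> real \<Rightarrow> real" where
  "max_modulus P r = (SUP z\<in>sphere 0 r. cmod (poly P z))"

definition min_modulus :: "complex poly \<Rightarrow> real \<Rightarrow> real" where
  "min_modulus P r = (INF z\<in>sphere 0 r. cmod (poly P z))"

lemma max_modulus_attained:
  assumes "r \<ge> 0"
  shows "\<exists>z\<in>sphere 0 r. cmod (poly P z) = max_modulus P r \<and>
           (\<forall>w\<in>sphere 0 r. cmod (poly P w) \<le> max_modulus P r)"
proof -
  have "continuous_on (sphere 0 r) (\<lambda>z. cmod (poly P z))"
    by (intro continuous_intros)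
  moreover have "sphere (0::complex) r \<noteq> {}"
    using assms by simp
  ultimately obtain z where z: "z \<in> sphere 0 r"
      "\<And>w. w \<in> sphere 0 r \<Longrightarrow> cmod (poly P w) \<le> cmod (poly P z)"
    using continuous_attains_sup[OF compact_sphere] by metis
  then have "max_modulus P r = cmod (poly P z)"
    unfolding max_modulus_def by (intro cSup_eq_maximum) auto
  with z show ?thesis by auto
qed

lemma min_modulus_attained:
  assumes "r \<ge> 0"
  shows "\<exists>z\<in>sphere 0 r. cmod (poly P z) = min_modulus P r \<and>
           (\<forall>w\<in>sphere 0 r. min_modulus P r \<le> cmod (poly P w))"
proof -
  have "continuous_on (sphere 0 r) (\<lambda>z. cmod (poly P z))"
    by (intro continuous_intros)
  moreover have "sphere (0::complex) r \<noteq> {}"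
    using assms by simp
  ultimately obtain z where z: "z \<in> sphere 0 r"
      "\<And>w. w \<in> sphere 0 r \<Longrightarrow> cmod (poly P z) \<le> cmod (poly P w)"
    using continuous_attains_inf[OF compact_sphere] by metis
  then have "min_modulus P r = cmod (poly P z)"
    unfolding min_modulus_def by (intro cInf_eq_minimum) auto
  with z show ?thesis by auto
qed

text \<open>
  When \<open>P\<close> has all its zeros in the closed disc of radius \<open>k\<close>, the denominator vanishes only
  for \<open>P = a\<^sub>n z\<^sup>n\<close>. There the quotient is \<open>0\<close> by the convention on division, but its value is
  immaterial: the two summands containing it in the main inequality cancel, because then
  \<open>min_modulus P k = k\<^sup>n * max_modulus P 1\<close>.
\<close>

definition A_const :: "complex poly \<Rightarrow> nat \<Rightarrow> real \<Rightarrow> real" where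
  "A_const P \<mu> k =
    (let n = degree P; m = min_modulus P k in
      (real n * (cmod (coeff P n) - m / k ^ n) * k ^ (2 * \<mu>)
         + real \<mu> * cmod (coeff P (n - \<mu>)) * k ^ (\<mu> - 1))
      / (real n * (cmod (coeff P n) - m / k ^ n) * k ^ (\<mu> - 1)
         + real \<mu> * cmod (coeff P (n - \<mu>))))"

end

theory Submission
  imports Defs "HOL-Computational_Algebra.Fundamental_Theorem_Algebra"
    "HOL-Complex_Analysis.Conformal_Mappings"
begin

text \<open>
  Write \<open>S = n P - z P'\<close>, which is the polar derivative with respect to \<open>0\<close>, and \<open>m' = m / k\<^sup>n\<close>.
  Since \<open>D\<^sub>\<alpha> P = \<alpha> P' + S\<close> and \<open>n P = z P' + S\<close>, everything on the unit circle follows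
  from one upper bound for \<open>\<bar>S\<bar>\<close> by a multiple of \<open>\<bar>P'\<bar>\<close>, used twice: it bounds \<open>\<bar>D\<^sub>\<alpha> P\<bar>\<close> from
  below by \<open>\<bar>\<alpha>\<bar> \<bar>P'\<bar> - \<bar>S\<bar>\<close>, and it bounds \<open>\<bar>P'\<bar>\<close> from below through \<open>n \<bar>P\<bar> \<le> \<bar>P'\<bar> + \<bar>S\<bar>\<close>.

  The bound itself is a Schwarz--Pick estimate. When all zeros of \<open>P\<close> lie in the disc of radius
  \<open>k\<close>, each zero \<open>w\<close> contributes at least \<open>1/2\<close> to \<open>Re (z P' / P) = \<Sum> Re (z / (z - w))\<close> for
  \<open>\<bar>z\<bar> \<ge> k\<close>, hence \<open>\<bar>S\<bar> \<le> \<bar>z P'\<bar>\<close> there (\<open>polar_part_le_deriv\<close>). So \<open>\<phi>(z) = S(1/z) / (P'(1/z) / z)\<close> is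
  bounded by \<open>1\<close> on the disc of radius \<open>1/k\<close>; because of the gap in the coefficients it vanishes to
  order \<open>\<mu>\<close> at \<open>0\<close>, with leading coefficient \<open>\<mu> a\<^bsub>n-\<mu>\<^esub> / (n a\<^sub>n)\<close>. Dividing by \<open>z\<^sup>\<mu>\<close> and applying
  Schwarz--Pick on the circle \<open>\<bar>z\<bar> = 1\<close> gives \<open>\<bar>S\<bar> \<le> A \<bar>P'\<bar>\<close>, where \<open>A\<close> is the constant of the
  theorem with \<open>m\<close> replaced by \<open>0\<close> (\<open>polar_part_le_refined\<close>).

  To make \<open>m\<close> appear, this is applied to \<open>P + l m' z\<^sup>n\<close> for \<open>\<bar>l\<bar> < 1\<close>. The minimum principle gives
  \<open>\<bar>P(z)\<bar> \<ge> m' \<bar>z\<bar>\<^sup>n\<close> outside the disc, so the perturbed polynomial still has its zeros in the disc.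
  The perturbation does not change \<open>S\<close>, since \<open>n z\<^sup>n - z (z\<^sup>n)' = 0\<close>, while a suitable argument of \<open>l\<close>
  lowers \<open>\<bar>P'\<bar>\<close> by \<open>\<bar>l\<bar> n m'\<close>. As \<open>A\<close> decreases in the leading coefficient, letting \<open>\<bar>l\<bar> \<rightarrow> 1\<close>
  yields \<open>\<bar>S\<bar> \<le> A\<^sub>\<mu> (\<bar>P'\<bar> - n m')\<close> if \<open>\<bar>a\<^sub>n\<bar> > m'\<close> (\<open>polar_part_le_refined_min\<close>). Otherwise
  \<open>\<bar>a\<^sub>n\<bar> = m'\<close>, and equality in the minimum principle makes \<open>P\<close> a monomial.
\<close>

section \<open>The logarithmic derivative outside a disc containing the zeros\<close>

text \<open>
  This is \<open>Re (u P'(u) / P(u)) \<ge> n / 2\<close>, multiplied by \<open>\<bar>P(u)\<bar>\<^sup>2\<close> so that it makes sense at zeros of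
  \<open>P\<close> as well. The induction splits off one linear factor \<open>u - w\<close> at a time; such a factor
  contributes \<open>Re (u / (u - w)) \<ge> 1/2\<close> because \<open>\<bar>w\<bar> \<le> \<bar>u\<bar>\<close>.
\<close>

lemma Re_cnj_mult_deriv_ge:
  assumes "\<And>w. poly P w = 0 \<Longrightarrow> cmod w \<le> cmod u"
  shows "real (degree P) / 2 * (cmod (poly P u))\<^sup>2 \<le> Re (cnj (poly P u) * (u * poly (pderiv P) u))"
  using assms
proof (induction "degree P" arbitrary: P)
  case 0
  then have "pderiv P = 0" by (simp add: pderiv_eq_0_iff)
  with 0 show ?case by simp
next
  case (Suc d)
  obtain w where w: "poly P w = 0"
    using alg_closed_imp_poly_has_root[of P] Suc.hyps(2) by auto
  then obtain Q where Q: "P = [:-w, 1:] * Q"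
    by (auto simp: poly_eq_0_iff_dvd dvd_def)
  have Q0: "Q \<noteq> 0" using Q Suc.hyps(2) by auto
  have dQ: "degree Q = d"
    using Suc.hyps(2) Q Q0 by (simp add: degree_mult_eq del: mult_pCons_left)
  have wu: "cmod w \<le> cmod u" using Suc.prems[OF w] .
  have IH: "real d / 2 * (cmod (poly Q u))\<^sup>2 \<le> Re (cnj (poly Q u) * (u * poly (pderiv Q) u))"
    using Suc.hyps(1)[of Q] dQ Suc.prems Q by auto
  have P': "poly (pderiv P) u = poly Q u + (u - w) * poly (pderiv Q) u"
    unfolding Q by (simp only: pderiv_mult poly_add poly_mult) (simp add: pderiv_pCons algebra_simps)
  have PQ: "poly P u = (u - w) * poly Q u"
    unfolding Q by (simp add: algebra_simps)
  have half_plane: "(cmod (u - w))\<^sup>2 / 2 \<le> Re (cnj (u - w) * u)"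
  proof -
    have "(cmod w)\<^sup>2 \<le> (cmod u)\<^sup>2" using wu by (simp add: power_mono)
    then show ?thesis
      unfolding cmod_power2 by (simp add: power2_eq_square field_simps)
  qed
  have "Re (cnj (poly P u) * (u * poly (pderiv P) u))
      = Re (of_real ((cmod (poly Q u))\<^sup>2) * (cnj (u - w) * u)
          + of_real ((cmod (u - w))\<^sup>2) * (cnj (poly Q u) * (u * poly (pderiv Q) u)))"
    unfolding P' PQ complex_norm_square complex_cnj_mult complex_cnj_diff
    by (simp only: algebra_simps)
  also have "\<dots> = (cmod (poly Q u))\<^sup>2 * Re (cnj (u - w) * u)
      + (cmod (u - w))\<^sup>2 * Re (cnj (poly Q u) * (u * poly (pderiv Q) u))"
    by (simp only: plus_complex.sel Re_complex_of_real Im_complex_of_real times_complex.sel(1))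
  also have "\<dots> \<ge> (cmod (poly Q u))\<^sup>2 * ((cmod (u - w))\<^sup>2 / 2)
      + (cmod (u - w))\<^sup>2 * (real d / 2 * (cmod (poly Q u))\<^sup>2)"
    using half_plane IH by (intro add_mono mult_left_mono) auto
  finally have lower: "(cmod (poly Q u))\<^sup>2 * ((cmod (u - w))\<^sup>2 / 2)
      + (cmod (u - w))\<^sup>2 * (real d / 2 * (cmod (poly Q u))\<^sup>2)
    \<le> Re (cnj (poly P u) * (u * poly (pderiv P) u))" .
  have "real (degree P) / 2 * (cmod (poly P u))\<^sup>2
    = (cmod (poly Q u))\<^sup>2 * ((cmod (u - w))\<^sup>2 / 2)
      + (cmod (u - w))\<^sup>2 * (real d / 2 * (cmod (poly Q u))\<^sup>2)"
    unfolding PQ norm_mult power_mult_distrib Suc.hyps(2)[symmetric] by (simp add: field_simps)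
  with lower show ?case by simp
qed

text \<open>
  The points \<open>t\<close> of the half-plane \<open>Re t \<ge> n / 2\<close> are those at least as close to \<open>n\<close> as to \<open>0\<close>.
\<close>

lemma polar_part_le_deriv:
  assumes "\<And>w. poly P w = 0 \<Longrightarrow> cmod w \<le> cmod u"
  shows "cmod (of_nat (degree P) * poly P u - u * poly (pderiv P) u) \<le> cmod (u * poly (pderiv P) u)"
proof -
  define p t n where "p = poly P u" and "t = u * poly (pderiv P) u" and "n = real (degree P)"
  have ge: "n / 2 * (cmod p)\<^sup>2 \<le> Re (cnj p * t)"
    unfolding p_def t_def n_def by (rule Re_cnj_mult_deriv_ge) fact
  have "(cmod (of_real n * p - t))\<^sup>2 = n\<^sup>2 * (cmod p)\<^sup>2 - 2 * n * Re (cnj p * t) + (cmod t)\<^sup>2"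
    by (simp add: cmod_power2) (simp add: power2_eq_square algebra_simps)
  also have "\<dots> \<le> (cmod t)\<^sup>2"
  proof -
    have "0 \<le> 2 * n" by (simp add: n_def)
    from mult_left_mono[OF ge this] show ?thesis by (simp add: power2_eq_square mult.assoc)
  qed
  finally have "cmod (of_real n * p - t) \<le> cmod t"
    by (rule power2_le_imp_le) simp
  then show ?thesis by (simp add: p_def t_def n_def)
qed

section \<open>A Schwarz--Pick estimate\<close>

lemma le_at_1_of_le_left:
  fixes f :: "real \<Rightarrow> real"
  assumes "continuous (at_left 1) f" "\<And>s. 0 < s \<Longrightarrow> s < 1 \<Longrightarrow> f s \<le> b"
  shows "f 1 \<le> b"
proof (rule tendsto_upperbound)
  show "(f \<longlongrightarrow> f 1) (at_left 1)" using assms(1) by (simp add: continuous_within)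
  show "\<forall>\<^sub>F s in at_left 1. f s \<le> b"
    using eventually_at_left_real[OF zero_less_one] by eventually_elim (use assms(2) in auto)
qed simp

text \<open>
  The points \<open>v\<close> of pseudo-hyperbolic distance at most \<open>r\<close> from \<open>c\<close> form a Euclidean disc; the bound is the
  largest modulus in that disc. Squaring reduces it to an inequality in \<open>\<bar>v\<bar>\<close>, \<open>\<bar>c\<bar>\<close> and the real part of
  \<open>cnj c * v\<close>, which may be replaced by its largest value \<open>\<bar>c\<bar> \<bar>v\<bar>\<close>.
\<close>

lemma pick_disc_le:
  fixes v c :: complex
  assumes "cmod v \<le> 1" "cmod c < 1" "0 \<le> r" "r \<le> 1" "cmod (v - c) \<le> r * cmod (1 - cnj c * v)"
  shows "cmod v \<le> (r + cmod c) / (1 + cmod c * r)"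
proof -
  define p q X where "p = cmod v" and "q = cmod c" and "X = Re (cnj c * v)"
  have X: "X \<le> p * q"
    unfolding X_def p_def q_def using complex_Re_le_cmod[of "cnj c * v"] by (simp add: norm_mult mult.commute)
  have pq: "0 \<le> p" "p \<le> 1" "0 \<le> q" "q < 1" using assms by (auto simp: p_def q_def)
  have e1: "(cmod (v - c))\<^sup>2 = p\<^sup>2 + q\<^sup>2 - 2 * X"
    unfolding p_def q_def X_def by (simp add: cmod_power2) (simp add: power2_eq_square algebra_simps)
  have e2: "(cmod (1 - cnj c * v))\<^sup>2 = 1 + p\<^sup>2 * q\<^sup>2 - 2 * X"
    unfolding p_def q_def X_def by (simp add: cmod_power2) (simp add: power2_eq_square algebra_simps)
  have "(cmod (v - c))\<^sup>2 \<le> r\<^sup>2 * (cmod (1 - cnj c * v))\<^sup>2"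
    using power_mono[OF assms(5), of 2] by (simp add: power_mult_distrib)
  then have "p\<^sup>2 + q\<^sup>2 - r\<^sup>2 * (1 + p\<^sup>2 * q\<^sup>2) \<le> 2 * X * (1 - r\<^sup>2)"
    unfolding e1 e2 by (simp add: algebra_simps)
  also have "\<dots> \<le> 2 * (p * q) * (1 - r\<^sup>2)"
    using X assms(3,4) by (intro mult_right_mono) (auto simp: power_le_one)
  finally have "(p - q)\<^sup>2 \<le> (r * (1 - p * q))\<^sup>2"
    by (simp add: power2_eq_square algebra_simps)
  moreover have "0 \<le> r * (1 - p * q)"
    using pq assms(3) by (intro mult_nonneg_nonneg) (auto intro: mult_le_one)
  ultimately have "p - q \<le> r * (1 - p * q)" by (rule power2_le_imp_le)
  then have "p * (1 + q * r) \<le> r + q" by (simp add: algebra_simps)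
  moreover have "0 < 1 + q * r" using pq assms(3) by (simp add: add_pos_nonneg)
  ultimately show ?thesis by (simp add: pos_le_divide_eq p_def q_def)
qed

text \<open>
  The Schwarz lemma applies to \<open>g\<close> followed by the disc automorphism that sends \<open>g 0\<close> to \<open>0\<close>.
\<close>

lemma Schwarz_Pick_at_0_strict:
  assumes hol: "g holomorphic_on ball 0 1" and lt1: "\<And>z. cmod z < 1 \<Longrightarrow> cmod (g z) < 1" and z: "cmod z < 1"
  shows "cmod (g z) \<le> (cmod z + cmod (g 0)) / (1 + cmod (g 0) * cmod z)"
proof -
  define c where "c = g 0"
  have c: "cmod c < 1" using lt1[of 0] by (simp add: c_def)
  define f where "f z = (g z - c) / (1 - cnj c * g z)" for z
  have nz: "1 - cnj c * g w \<noteq> 0" if "cmod w < 1" for w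
  proof
    assume "1 - cnj c * g w = 0"
    then have "cmod (cnj c * g w) = 1" by simp
    moreover have "cmod c * cmod (g w) < 1"
      using mult_left_le[of "cmod (g w)" "cmod c"] lt1[OF that] c by simp
    ultimately show False by (simp add: norm_mult)
  qed
  have "cmod (f z) \<le> cmod z"
  proof (rule Schwarz_Lemma)
    show "f holomorphic_on ball 0 1"
      unfolding f_def using nz by (intro holomorphic_intros hol) auto
    show "f 0 = 0" by (simp add: f_def c_def)
    show "cmod z < 1" by fact
    fix w :: complex assume w: "cmod w < 1"
    have "(cmod (1 - cnj c * g w))\<^sup>2 - (cmod (g w - c))\<^sup>2 = (1 - (cmod (g w))\<^sup>2) * (1 - (cmod c)\<^sup>2)"
      by (simp add: cmod_power2) (simp add: power2_eq_square algebra_simps)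
    also have "\<dots> > 0"
      using lt1[OF w] c by (intro mult_pos_pos) (auto simp: power_less_one_iff abs_square_less_1)
    finally have "cmod (g w - c) < cmod (1 - cnj c * g w)"
      by (simp add: power2_less_imp_less)
    then show "cmod (f w) < 1" by (simp add: f_def norm_divide divide_less_eq)
  qed
  then have "cmod (g z - c) \<le> cmod z * cmod (1 - cnj c * g z)"
    using nz[OF z] by (simp add: f_def norm_divide pos_divide_le_eq)
  then show ?thesis
    using pick_disc_le[of "g z" c "cmod z"] c z lt1[OF z] by (simp add: c_def)
qed

text \<open>
  A limit over the multiples \<open>s g\<close> with \<open>s < 1\<close> reduces this to the strict case and covers unimodular
  constants too.
\<close>

lemma Schwarz_Pick_at_0:
  assumes hol: "g holomorphic_on ball 0 1" and le1: "\<And>z. cmod z < 1 \<Longrightarrow> cmod (g z) \<le> 1" and z: "cmod z < 1"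
  shows "cmod (g z) \<le> (cmod z + cmod (g 0)) / (1 + cmod (g 0) * cmod z)"
proof -
  let ?f = "\<lambda>s. s * cmod (g z) - (cmod z + s * cmod (g 0)) / (1 + s * cmod (g 0) * cmod z)"
  have pos: "1 + s * cmod (g 0) * cmod z > 0" if "s \<ge> 0" for s
    using that by (simp add: add_pos_nonneg)
  have "?f 1 \<le> 0"
  proof (rule le_at_1_of_le_left[where f = ?f])
    show "continuous (at_left 1) ?f"
      using pos[of 1] by (intro continuous_intros) auto
    fix s :: real assume s: "0 < s" "s < 1"
    have "cmod (of_real s * g z) \<le> (cmod z + cmod (of_real s * g 0)) / (1 + cmod (of_real s * g 0) * cmod z)"
    proof (rule Schwarz_Pick_at_0_strict[OF _ _ z])
      show "(\<lambda>z. of_real s * g z) holomorphic_on ball 0 1" by (intro holomorphic_intros hol)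
      fix w :: complex assume "cmod w < 1"
      then have "s * cmod (g w) \<le> s" using le1 s by (intro mult_left_le) auto
      from le_less_trans[OF this s(2)] show "cmod (of_real s * g w) < 1"
        using s by (simp add: norm_mult)
    qed
    then show "?f s \<le> 0" using s by (simp add: norm_mult)
  qed
  then show ?thesis by simp
qed

text \<open>
  On the circle of radius \<open>s\<close> the hypothesis says \<open>\<bar>g\<bar> \<le> s\<^bsup>-\<mu>\<^esup>\<close>; the maximum principle carries
  this inside, and \<open>s\<close> tends to \<open>1\<close>.
\<close>

lemma norm_cofactor_le_1:
  assumes hol: "g holomorphic_on ball 0 1" and le1: "\<And>z. cmod z < 1 \<Longrightarrow> cmod (z ^ \<mu> * g z) \<le> 1"
    and z: "cmod z < 1"
  shows "cmod (g z) \<le> 1"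
proof -
  have "1 ^ \<mu> * cmod (g z) \<le> 1"
  proof (rule tendsto_upperbound[where F="at_left 1" and f="\<lambda>s. s ^ \<mu> * cmod (g z)"])
    show "((\<lambda>s. s ^ \<mu> * cmod (g z)) \<longlongrightarrow> 1 ^ \<mu> * cmod (g z)) (at_left 1)"
      by (intro tendsto_intros)
    show "\<forall>\<^sub>F s in at_left 1. s ^ \<mu> * cmod (g z) \<le> 1"
      using eventually_at_left_real[OF z]
    proof eventually_elim
      case (elim s)
      then have s: "cmod z < s" "s < 1" "0 < s" using norm_ge_zero[of z] by (auto simp del: norm_ge_zero)
      have sub: "cball 0 s \<subseteq> ball (0::complex) 1" using s by auto
      have "cmod (g z) \<le> 1 / s ^ \<mu>"
      proof (rule maximum_modulus_frontier[of g "cball 0 s"])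
        show "g holomorphic_on interior (cball 0 s)"
          using hol by (rule holomorphic_on_subset) (use s in auto)
        show "continuous_on (closure (cball 0 s)) g"
          using holomorphic_on_imp_continuous_on[OF holomorphic_on_subset[OF hol sub]] by simp
        show "z \<in> cball 0 s" using s by simp
        fix w :: complex assume "w \<in> frontier (cball 0 s)"
        then have w: "cmod w = s" by simp
        then show "cmod (g w) \<le> 1 / s ^ \<mu>"
          using le1[of w] s by (simp add: norm_mult norm_power pos_le_divide_eq mult.commute)
      qed simp
      then show ?case using s by (simp add: pos_le_divide_eq mult.commute)
    qed
  qed simp
  then show ?thesis by simp
qed

section \<open>The constant of the theorem as a function of the leading coefficient\<close>

text \<open>
  The constant \<open>A_const\<close> with the modulus \<open>x\<close> of the leading coefficient and the modulus \<open>b\<close> of the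
  next possible coefficient as free parameters: the proof compares its values at different \<open>x\<close>.
\<close>

definition refined_radius :: "nat \<Rightarrow> nat \<Rightarrow> real \<Rightarrow> real \<Rightarrow> real \<Rightarrow> real" where
  "refined_radius n \<mu> k x b = (real n * x * k ^ (2 * \<mu>) + real \<mu> * b * k ^ (\<mu> - 1))
     / (real n * x * k ^ (\<mu> - 1) + real \<mu> * b)"

lemma A_const_eq_refined_radius:
  "A_const P \<mu> k = refined_radius (degree P) \<mu> k
     (cmod (lead_coeff P) - min_modulus P k / k ^ degree P) (cmod (coeff P (degree P - \<mu>)))"
  by (simp add: A_const_def refined_radius_def Let_def)

context
  fixes n \<mu> :: nat and k x b :: real
  assumes \<mu>: "1 \<le> \<mu>" and n: "0 < n" and k: "0 < k" "k \<le> 1" and x: "0 < x" and b: "0 \<le> b"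
begin

lemma refined_radius_denom_pos: "0 < real n * x * k ^ (\<mu> - 1) + real \<mu> * b"
  using n x k b by (intro add_pos_nonneg) auto

text \<open>
  After cross-multiplication, with \<open>p = k\<^bsup>\<mu>-1\<^esup>\<close>, the difference of the two sides is
  \<open>\<mu> b n p\<^sup>2 (1 - k\<^sup>2) (y - x)\<close>.
\<close>

lemma refined_radius_antimono:
  assumes "x \<le> y"
  shows "refined_radius n \<mu> k y b \<le> refined_radius n \<mu> k x b"
proof -
  define X Y B p where "X = real n * x" and "Y = real n * y" and "B = real \<mu> * b" and "p = k ^ (\<mu> - 1)"
  have kp: "k ^ (2 * \<mu>) = k\<^sup>2 * p\<^sup>2"
    using \<mu> by (cases \<mu>) (simp_all add: p_def power_mult power2_eq_square algebra_simps power_add[symmetric] mult_2)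
  have XY: "0 < X" "X \<le> Y" "0 \<le> B" "0 < p"
    using n x b k assms by (auto simp: X_def Y_def B_def p_def)
  have "k\<^sup>2 \<le> 1" using k by (simp add: power_le_one)
  then have "0 \<le> B * p\<^sup>2 * ((1 - k\<^sup>2) * (Y - X))"
    using XY by simp
  then have "(Y * (k\<^sup>2 * p\<^sup>2) + B * p) * (X * p + B) \<le> (X * (k\<^sup>2 * p\<^sup>2) + B * p) * (Y * p + B)"
    by (simp add: algebra_simps power2_eq_square)
  moreover have "0 < X * p + B" "0 < Y * p + B"
    using XY by (auto intro!: add_pos_nonneg)
  ultimately show ?thesis
    unfolding refined_radius_def kp X_def[symmetric] Y_def[symmetric] B_def[symmetric] p_def[symmetric]
    by (simp add: frac_le_eq divide_le_0_iff divide_simps)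
qed

lemma refined_radius_le_power:
  assumes "real \<mu> * b \<le> real n * x * k ^ \<mu>"
  shows "refined_radius n \<mu> k x b \<le> k ^ \<mu>"
proof -
  define X B p where "X = real n * x" and "B = real \<mu> * b" and "p = k ^ (\<mu> - 1)"
  have kp: "k ^ (2 * \<mu>) = k\<^sup>2 * p\<^sup>2" "k ^ \<mu> = k * p"
    using \<mu> by (cases \<mu>; simp add: p_def power_mult power2_eq_square algebra_simps power_add[symmetric] mult_2)+
  have "0 \<le> p * ((1 - k) * (X * (k * p) - B))"
    using assms k unfolding X_def B_def kp by (simp add: p_def)
  then have "X * (k\<^sup>2 * p\<^sup>2) + B * p \<le> (k * p) * (X * p + B)"
    by (simp add: algebra_simps power2_eq_square)
  then show ?thesis
    using refined_radius_denom_pos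
    unfolding refined_radius_def kp X_def[symmetric] B_def[symmetric] p_def[symmetric]
    by (simp add: pos_divide_le_eq)
qed

text \<open>
  The left-hand side is the form in which Schwarz--Pick produces the constant: \<open>c\<close> is the value at
  \<open>0\<close> of the normalised cofactor, and \<open>k\<close> is the rescaled radius of the unit circle.
\<close>

lemma refined_radius_eq_Schwarz_Pick:
  assumes "c = real \<mu> * b / (real n * x * k ^ \<mu>)"
  shows "k ^ \<mu> * ((k + c) / (1 + c * k)) = refined_radius n \<mu> k x b"
proof -
  define X B p where "X = real n * x" and "B = real \<mu> * b" and "p = k ^ (\<mu> - 1)"
  have kp: "k ^ (2 * \<mu>) = k\<^sup>2 * p\<^sup>2" "k ^ \<mu> = k * p"
    using \<mu> by (cases \<mu>; simp add: p_def power_mult power2_eq_square algebra_simps power_add[symmetric] mult_2)+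
  have pos: "0 < X" "0 < p" "0 < X * p + B"
    using n x k refined_radius_denom_pos by (auto simp: X_def p_def B_def)
  have c: "c = B / (X * (k * p))" using assms by (simp add: X_def B_def kp)
  define N where "N = X * p + B"
  have N: "0 < N" using pos by (simp add: N_def)
  have eqs: "1 + c * k = N / (X * p)" "k + c = (X * (k\<^sup>2 * p) + B) / (X * (k * p))"
    using pos k by (simp_all add: c N_def field_simps power2_eq_square)
  have "k * p * ((k + c) / (1 + c * k)) = (X * (k\<^sup>2 * p\<^sup>2) + B * p) / N"
    using pos(1,2) N k unfolding eqs by (simp add: field_simps power2_eq_square)
  then show ?thesis
    unfolding refined_radius_def kp N_def X_def B_def p_def by (simp add: mult.assoc)
qed

end

section \<open>The bound in terms of the leading coefficient\<close>

text \<open>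
  The variable is inverted with \<open>reflect_poly\<close>: if \<open>R\<close> is the reflected polynomial, then \<open>D = z R'\<close>
  and \<open>T = n R - z R'\<close> are the reflections of \<open>n P - z P'\<close> and \<open>z P'\<close>. The quotient \<open>D / T\<close> is
  bounded by \<open>1\<close> on the disc of radius \<open>1/k\<close>, and \<open>D\<close> is divisible by \<open>z\<^sup>\<mu>\<close> because of the gap.
  Schwarz--Pick for the cofactor, rescaled to the unit disc, gives the second claim; the first one
  says that the cofactor is bounded by \<open>1\<close> at the origin.
\<close>

lemma polar_part_le_refined:
  fixes P :: "complex poly"
  defines "n \<equiv> degree P"
  assumes \<mu>: "1 \<le> \<mu>" "\<mu> \<le> n" and k: "0 < k" "k \<le> 1"
    and gap: "\<And>j. 1 \<le> j \<Longrightarrow> j < \<mu> \<Longrightarrow> coeff P (n - j) = 0"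
    and zeros: "\<And>w. poly P w = 0 \<Longrightarrow> cmod w \<le> k"
  shows "real \<mu> * cmod (coeff P (n - \<mu>)) \<le> real n * cmod (lead_coeff P) * k ^ \<mu>" (is ?coeff)
    and "cmod u = 1 \<Longrightarrow> cmod (of_nat n * poly P u - u * poly (pderiv P) u)
      \<le> refined_radius n \<mu> k (cmod (lead_coeff P)) (cmod (coeff P (n - \<mu>))) * cmod (poly (pderiv P) u)"
      (is "_ \<Longrightarrow> ?bound")
proof -
  have n: "0 < n" using \<mu> by simp
  then have lead: "lead_coeff P \<noteq> 0" by (auto simp: n_def)
  define R where "R = reflect_poly P"
  define D where "D = pCons 0 (pderiv R)"
  define T where "T = smult (of_nat n) R - D"
  have coeff_D: "coeff D i = of_nat i * coeff R i" for i
    by (cases i) (simp_all add: D_def coeff_pderiv)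
  have deg: "degree (pCons 0 (pderiv P)) = n"
  proof -
    have "pderiv P \<noteq> 0" using n by (simp add: pderiv_eq_0_iff n_def)
    then show ?thesis using n by (simp add: degree_pderiv n_def)
  qed
  have T_reflect: "T = reflect_poly (pCons 0 (pderiv P))"
  proof (rule poly_eqI)
    fix i
    have "coeff (pCons 0 (pderiv P)) j = of_nat j * coeff P j" for j
      by (cases j) (simp_all add: coeff_pderiv)
    then show "coeff T i = coeff (reflect_poly (pCons 0 (pderiv P))) i"
      unfolding coeff_reflect_poly deg
      by (simp add: T_def coeff_D R_def coeff_reflect_poly n_def[symmetric] of_nat_diff algebra_simps)
  qed
  have T_poly: "poly T z = z ^ n * (inverse z * poly (pderiv P) (inverse z))" if "z \<noteq> 0" for z
    using poly_reflect_poly_nz[OF that, of "pCons 0 (pderiv P)"] unfolding T_reflect deg by simp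
  have R_poly: "poly R z = z ^ n * poly P (inverse z)" if "z \<noteq> 0" for z
    using poly_reflect_poly_nz[OF that, of P] by (simp add: R_def n_def)
  have D_poly: "poly D z = z ^ n * (of_nat n * poly P (inverse z) - inverse z * poly (pderiv P) (inverse z))"
    if "z \<noteq> 0" for z
  proof -
    have "poly D z = of_nat n * poly R z - poly T z" by (simp add: T_def)
    then show ?thesis by (simp only: T_poly[OF that] R_poly[OF that]) (simp add: algebra_simps)
  qed
  have D_le_T: "cmod (poly D z) \<le> cmod (poly T z)" if z: "cmod z \<le> 1 / k" for z
  proof (cases "z = 0")
    case True
    then show ?thesis by (simp add: D_def)
  next
    case False
    have "k \<le> cmod (inverse z)"
      using z False k by (simp add: norm_inverse) (simp add: field_simps)
    then have "\<And>w. poly P w = 0 \<Longrightarrow> cmod w \<le> cmod (inverse z)"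
      using zeros by force
    from polar_part_le_deriv[of P, OF this, folded n_def] show ?thesis
      unfolding D_poly[OF False] T_poly[OF False] norm_mult
      by (intro mult_left_mono) (auto simp: norm_mult)
  qed
  have T_0: "poly T 0 = of_nat n * lead_coeff P"
    by (simp add: T_def D_def R_def)
  have T_nz: "poly T z \<noteq> 0" if z: "cmod z < 1 / k" for z
  proof (cases "z = 0")
    case True
    then show ?thesis using T_0 n lead by simp
  next
    case False
    show ?thesis
    proof
      assume "poly T z = 0"
      then have "poly R z = 0" using D_le_T[of z] z n by (auto simp: T_def)
      then have "cmod (inverse z) \<le> k" using R_poly[OF False] False zeros by simp
      then show False using z False k by (simp add: norm_inverse) (simp add: field_simps)
    qed
  qed
  have "coeff D j = 0" if "j < \<mu>" for j
    using that gap[of j] \<mu> by (cases "j = 0") (simp_all add: coeff_D R_def coeff_reflect_poly n_def)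
  then have "monom 1 \<mu> dvd D" by (simp add: monom_1_dvd_iff')
  then obtain H where H: "D = monom 1 \<mu> * H" by (auto simp: dvd_def)
  have H_poly: "poly D z = z ^ \<mu> * poly H z" for z by (simp add: H poly_monom)
  have "coeff D \<mu> = coeff H 0" by (simp add: H coeff_monom_mult)
  then have H_0: "poly H 0 = of_nat \<mu> * coeff P (n - \<mu>)"
    using \<mu> by (simp add: coeff_D R_def coeff_reflect_poly n_def poly_0_coeff_0)
  define g where "g z = poly H (z / of_real k) / (of_real k ^ \<mu> * poly T (z / of_real k))" for z
  have scaled: "cmod (z / of_real k) < 1 / k" if "cmod z < 1" for z
    using that k by (simp add: norm_divide divide_strict_right_mono)
  have hol: "g holomorphic_on ball 0 1"
    unfolding g_def using T_nz scaled k by (intro holomorphic_intros) auto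
  have power_le: "cmod (z ^ \<mu> * g z) \<le> 1" if z: "cmod z < 1" for z
  proof -
    have "z ^ \<mu> * g z = poly D (z / of_real k) / poly T (z / of_real k)"
      by (simp add: g_def H_poly power_divide)
    then show ?thesis
      using D_le_T[OF less_imp_le[OF scaled[OF z]]] T_nz[OF scaled[OF z]]
      by (simp add: norm_divide)
  qed
  have g_le: "cmod (g z) \<le> 1" if "cmod z < 1" for z
    by (rule norm_cofactor_le_1[OF hol power_le that])
  have g_0: "cmod (g 0) = real \<mu> * cmod (coeff P (n - \<mu>)) / (real n * cmod (lead_coeff P) * k ^ \<mu>)"
    using k by (simp add: g_def H_0 T_0 norm_divide norm_mult norm_power)
  show ?coeff
    using g_le[of 0] n lead k unfolding g_0 by (simp add: pos_divide_le_eq)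
  have x: "0 < cmod (lead_coeff P)" using lead by simp
  show ?bound if u: "cmod u = 1"
  \<comment> \<open>For \<open>k = 1\<close> the unit circle bounds the disc on which \<open>g\<close> is controlled, but then the constant is \<open>1\<close>.\<close>
  proof (cases "k = 1")
    case True
    have "refined_radius n \<mu> k (cmod (lead_coeff P)) (cmod (coeff P (n - \<mu>))) = 1"
      using refined_radius_denom_pos[OF \<mu>(1) n k x norm_ge_zero, of "coeff P (n - \<mu>)"] True
      by (simp add: refined_radius_def)
    then show ?thesis
      using polar_part_le_deriv[of P u] zeros u True by (simp add: n_def norm_mult)
  next
    case False
    then have k1: "k < 1" using k by simp
    \<comment> \<open>The point of the unit disc that the rescaling sends to \<open>1/u\<close>.\<close>
    define z where "z = of_real k * inverse u"
    have u0: "u \<noteq> 0" using u by auto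
    have z: "cmod z = k" "z / of_real k = inverse u"
      using k u by (simp_all add: z_def norm_mult norm_inverse)
    have "cmod (g z) = cmod (poly D (inverse u)) / (k ^ \<mu> * cmod (poly T (inverse u)))"
      unfolding g_def z(2) H_poly using k u by (simp add: norm_divide norm_mult norm_power norm_inverse)
    also have "cmod (poly D (inverse u)) = cmod (of_nat n * poly P u - u * poly (pderiv P) u)"
      using D_poly[of "inverse u"] u0 u by (simp add: norm_mult norm_power norm_inverse)
    also have "cmod (poly T (inverse u)) = cmod (poly (pderiv P) u)"
      using T_poly[of "inverse u"] u0 u by (simp add: norm_mult norm_power norm_inverse)
    finally have g_z: "cmod (g z)
      = cmod (of_nat n * poly P u - u * poly (pderiv P) u) / (k ^ \<mu> * cmod (poly (pderiv P) u))" .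
    have "cmod (inverse u) < 1 / k" using u k k1 by (simp add: norm_inverse)
    then have "poly (pderiv P) u \<noteq> 0"
      using T_nz[of "inverse u"] T_poly[of "inverse u"] u0 by auto
    then have "cmod (of_nat n * poly P u - u * poly (pderiv P) u)
        = k ^ \<mu> * cmod (g z) * cmod (poly (pderiv P) u)"
      using g_z k by simp
    also have "\<dots> \<le> k ^ \<mu> * ((k + cmod (g 0)) / (1 + cmod (g 0) * k)) * cmod (poly (pderiv P) u)"
      using Schwarz_Pick_at_0[OF hol g_le, of z] k1 k z
      by (intro mult_right_mono mult_left_mono) auto
    also have "\<dots> = refined_radius n \<mu> k (cmod (lead_coeff P)) (cmod (coeff P (n - \<mu>))) * cmod (poly (pderiv P) u)"
      using refined_radius_eq_Schwarz_Pick[OF \<mu>(1) n k x norm_ge_zero g_0] by simp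
    finally show ?thesis .
  qed
qed

section \<open>Minimum principle outside the disc\<close>

lemma min_modulus_nonneg: "0 \<le> r \<Longrightarrow> 0 \<le> min_modulus P r"
  using min_modulus_attained[of r P] by (metis norm_ge_zero)

text \<open>
  The maximum principle for \<open>1 / R\<close> on the disc of radius \<open>1/k\<close>, where \<open>R\<close> is the reflected
  polynomial: \<open>R\<close> has no zeros there unless the minimum of \<open>\<bar>P\<bar>\<close> vanishes, its value at \<open>0\<close> is the
  leading coefficient, and equality at this interior point forces \<open>R\<close> to be constant.
\<close>

lemma
  fixes P :: "complex poly"
  assumes "P \<noteq> 0" and k: "0 < k" and zeros: "\<And>w. poly P w = 0 \<Longrightarrow> cmod w \<le> k"
  shows min_modulus_le_outside:
      "k \<le> cmod u \<Longrightarrow> min_modulus P k / k ^ degree P * cmod u ^ degree P \<le> cmod (poly P u)"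
    and min_modulus_le_lead_coeff: "min_modulus P k / k ^ degree P \<le> cmod (lead_coeff P)"
    and min_modulus_eq_lead_coeff_imp:
      "cmod (lead_coeff P) = min_modulus P k / k ^ degree P \<Longrightarrow> k \<le> cmod u \<Longrightarrow>
        cmod (poly P u) = cmod (lead_coeff P) * cmod u ^ degree P"
proof -
  define n m where "n = degree P" and "m = min_modulus P k / k ^ n"
  define R where "R = reflect_poly P"
  have lead: "lead_coeff P \<noteq> 0" using \<open>P \<noteq> 0\<close> by simp
  have R_0: "poly R 0 = lead_coeff P" by (simp add: R_def)
  have R_poly: "poly R z = z ^ n * poly P (inverse z)" if "z \<noteq> 0" for z
    using poly_reflect_poly_nz[OF that, of P] by (simp add: R_def n_def)
  have min_le: "\<And>z. cmod z = k \<Longrightarrow> min_modulus P k \<le> cmod (poly P z)"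
    using min_modulus_attained[of k P] k by auto
  have R_rev: "cmod (poly P u) = cmod (poly R (inverse u)) * cmod u ^ n" if "k \<le> cmod u" for u
  proof -
    have "u \<noteq> 0" using that k by auto
    then have "poly R (inverse u) = inverse u ^ n * poly P u" using R_poly[of "inverse u"] by simp
    then show ?thesis
      using \<open>u \<noteq> 0\<close> by (simp add: norm_mult norm_power norm_inverse) (simp add: field_simps)
  qed
  have m_ge: "0 \<le> m" using min_modulus_nonneg[of k P] k by (simp add: m_def)
  have key: "(\<forall>z. cmod z \<le> 1 / k \<longrightarrow> m \<le> cmod (poly R z)) \<and>
    (cmod (lead_coeff P) = m \<longrightarrow> (\<forall>z. cmod z \<le> 1 / k \<longrightarrow> poly R z = poly R 0))"
  proof (cases "m = 0")
    case True
    then show ?thesis using lead by auto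
  next
    case False
    then have m: "0 < m" using m_ge by simp
    have R_sphere: "m \<le> cmod (poly R z)" if "cmod z = 1 / k" for z
    proof -
      have z: "z \<noteq> 0" "cmod (inverse z) = k" using that k by (auto simp: norm_inverse)
      have "cmod (poly R z) = (1 / k) ^ n * cmod (poly P (inverse z))"
        using R_poly[OF z(1)] that by (simp add: norm_mult norm_power)
      then show ?thesis using min_le[OF z(2)] k by (simp add: m_def power_one_over divide_simps)
    qed
    have R_nz: "poly R z \<noteq> 0" if z: "cmod z \<le> 1 / k" for z
    proof
      assume R0: "poly R z = 0"
      then have "z \<noteq> 0" using R_0 lead by auto
      then have "cmod (inverse z) \<le> k" using R_poly[of z] R0 zeros by simp
      then have "cmod z = 1 / k"
        using \<open>z \<noteq> 0\<close> k z by (simp add: norm_inverse) (simp add: field_simps)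
      with R_sphere R0 m show False by force
    qed
    let ?f = "\<lambda>z. 1 / poly R z"
    have cont: "continuous_on (cball 0 (1 / k)) ?f"
      using R_nz by (intro continuous_intros) auto
    have hol: "?f holomorphic_on ball 0 (1 / k)"
      using R_nz by (intro holomorphic_intros) auto
    have f_le: "cmod (?f z) \<le> 1 / m" if "cmod z \<le> 1 / k" for z
    proof (rule maximum_modulus_frontier[of ?f "cball 0 (1 / k)"])
      show "?f holomorphic_on interior (cball 0 (1 / k))" using hol by simp
      show "continuous_on (closure (cball 0 (1 / k))) ?f" using cont by simp
      show "z \<in> cball 0 (1 / k)" using that by simp
      fix w :: complex assume "w \<in> frontier (cball 0 (1 / k))"
      then have "m \<le> cmod (poly R w)" using R_sphere k by simp
      then show "cmod (?f w) \<le> 1 / m" using m by (simp add: norm_divide frac_le)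
    qed simp
    have "m \<le> cmod (poly R z)" if "cmod z \<le> 1 / k" for z
      using f_le[OF that] R_nz[OF that] m by (simp add: norm_divide field_simps)
    moreover have "poly R z = poly R 0" if "cmod (lead_coeff P) = m" "cmod z \<le> 1 / k" for z
    proof -
      have "?f constant_on ball 0 (1 / k)"
      proof (rule maximum_modulus_principle[OF hol])
        show "\<And>w. w \<in> ball 0 (1 / k) \<Longrightarrow> cmod (?f w) \<le> cmod (?f 0)"
          using f_le that(1) by (simp add: norm_divide R_0)
      qed (use k in auto)
      then have "?f constant_on closure (ball 0 (1 / k))"
        using cont k by (intro constant_on_closureI) auto
      then have "?f constant_on cball 0 (1 / k)" using k by simp
      then obtain y where "\<And>w. w \<in> cball 0 (1 / k) \<Longrightarrow> ?f w = y"
        unfolding constant_on_def by blast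
      from this[of z] this[of 0] have "?f z = ?f 0" using that(2) k by simp
      then show ?thesis by simp
    qed
    ultimately show ?thesis by blast
  qed
  have inv: "cmod (inverse u) \<le> 1 / k" if "k \<le> cmod u" for u
    using that k by (simp add: norm_inverse) (simp add: inverse_eq_divide frac_le)
  show "min_modulus P k / k ^ degree P * cmod u ^ degree P \<le> cmod (poly P u)" if "k \<le> cmod u"
    using key inv[OF that] R_rev[OF that] unfolding n_def[symmetric] m_def[symmetric]
    by (auto intro: mult_right_mono)
  show "min_modulus P k / k ^ degree P \<le> cmod (lead_coeff P)"
    using key k R_0 unfolding n_def[symmetric] m_def[symmetric]
    by (metis divide_nonneg_pos norm_zero zero_le_one)
  show "cmod (poly P u) = cmod (lead_coeff P) * cmod u ^ degree P"
    if "cmod (lead_coeff P) = min_modulus P k / k ^ degree P" "k \<le> cmod u"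
    using key inv[OF that(2)] R_rev[OF that(2)] that(1) R_0 unfolding n_def[symmetric] m_def[symmetric]
    by auto
qed

section \<open>Perturbing the leading coefficient\<close>

text \<open>
  A zero of the perturbed polynomial outside the disc would force \<open>\<bar>P(w)\<bar> = \<bar>l\<bar> m \<bar>w\<bar>\<^sup>n\<close>, contrary
  to \<open>\<bar>P(w)\<bar> \<ge> m \<bar>w\<bar>\<^sup>n\<close>. The last claim is what makes the perturbation useful: it leaves
  \<open>n P - z P'\<close> unchanged.
\<close>

lemma zeros_of_perturbed_lead_coeff:
  fixes P :: "complex poly"
  assumes deg: "0 < degree P" and k: "0 < k" and zeros: "\<And>w. poly P w = 0 \<Longrightarrow> cmod w \<le> k"
    and l: "cmod l < 1"
  defines "m \<equiv> min_modulus P k / k ^ degree P"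
  defines "F \<equiv> P + monom (l * of_real m) (degree P)"
  shows "degree F = degree P"
    and "\<And>w. poly F w = 0 \<Longrightarrow> cmod w \<le> k"
    and "\<And>i. i \<noteq> degree P \<Longrightarrow> coeff F i = coeff P i"
    and "lead_coeff F = lead_coeff P + l * of_real m"
    and "\<And>w. poly (pderiv F) w = poly (pderiv P) w + l * of_real (real (degree P) * m) * w ^ (degree P - 1)"
    and "\<And>w. of_nat (degree P) * poly F w - w * poly (pderiv F) w
           = of_nat (degree P) * poly P w - w * poly (pderiv P) w"
proof -
  have P: "P \<noteq> 0" using deg by auto
  have lead: "lead_coeff P \<noteq> 0" using P by simp
  have m_le: "m \<le> cmod (lead_coeff P)"
    unfolding m_def by (rule min_modulus_le_lead_coeff[OF P k zeros])
  have m_ge: "0 \<le> m" using min_modulus_nonneg[of k P] k by (simp add: m_def)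
  have "cmod (l * of_real m) < cmod (lead_coeff P)"
  proof (cases "m = 0")
    case False
    then have "cmod l * m < 1 * m" using l m_ge by (intro mult_strict_right_mono) auto
    then show ?thesis using m_le m_ge by (simp add: norm_mult)
  qed (use lead in simp)
  then have top: "lead_coeff P + l * of_real m \<noteq> 0"
    by (metis add.inverse_unique norm_minus_cancel order_less_irrefl)
  have coeff_F: "coeff F i = coeff P i + (if i = degree P then l * of_real m else 0)" for i
    by (simp add: F_def)
  show deg_F: "degree F = degree P"
  proof (rule antisym)
    show "degree F \<le> degree P"
      unfolding F_def by (intro degree_add_le) (auto simp: degree_monom_le)
    show "degree P \<le> degree F"
      by (rule le_degree) (use top in \<open>simp add: coeff_F\<close>)
  qed
  show "coeff F i = coeff P i" if "i \<noteq> degree P" for i using that by (simp add: coeff_F)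
  show "lead_coeff F = lead_coeff P + l * of_real m" by (simp add: coeff_F deg_F)
  show F': "poly (pderiv F) w = poly (pderiv P) w + l * of_real (real (degree P) * m) * w ^ (degree P - 1)" for w
    by (simp add: F_def pderiv_add pderiv_monom poly_monom algebra_simps)
  have "w ^ degree P = w * w ^ (degree P - 1)" for w :: complex
    using deg by (cases "degree P") auto
  then show "of_nat (degree P) * poly F w - w * poly (pderiv F) w
      = of_nat (degree P) * poly P w - w * poly (pderiv P) w" for w
    unfolding F' by (simp add: F_def poly_monom algebra_simps)
  show "cmod w \<le> k" if "poly F w = 0" for w
  proof (rule ccontr)
    assume far: "\<not> cmod w \<le> k"
    then have nz: "poly P w \<noteq> 0" using zeros by auto
    have "poly P w = - (l * of_real m * w ^ degree P)"
      using that by (simp add: F_def poly_monom eq_neg_iff_add_eq_0)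
    then have eq: "cmod (poly P w) = cmod l * (m * cmod w ^ degree P)"
      using m_ge by (simp add: norm_mult norm_power)
    have le: "m * cmod w ^ degree P \<le> cmod (poly P w)"
      unfolding m_def by (rule min_modulus_le_outside[OF P k zeros]) (use far in auto)
    have pos: "0 < m * cmod w ^ degree P"
      using eq nz m_ge by (cases "m * cmod w ^ degree P = 0") (auto simp: zero_less_mult_iff)
    then have "cmod l * (m * cmod w ^ degree P) < 1 * (m * cmod w ^ degree P)"
      using l by (intro mult_strict_right_mono)
    with eq le show False by simp
  qed
qed

text \<open>
  The bound is stated for any \<open>A\<close> that dominates the constants of all perturbed polynomials. When
  \<open>x > 0\<close> the best choice is the constant at \<open>x\<close> itself; \<open>k\<^sup>\<mu>\<close> is always admissible and serves the
  degenerate case \<open>x = 0\<close>, in which the quotient defining the constant is \<open>0 / 0\<close>.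
\<close>

lemma polar_part_le_refined_min:
  fixes P :: "complex poly" and k :: real
  defines "n \<equiv> degree P"
  defines "m \<equiv> min_modulus P k / k ^ degree P"
  defines "x \<equiv> cmod (lead_coeff P) - min_modulus P k / k ^ degree P"
  assumes \<mu>: "1 \<le> \<mu>" "\<mu> \<le> n" and k: "0 < k" "k \<le> 1"
    and gap: "\<And>j. 1 \<le> j \<Longrightarrow> j < \<mu> \<Longrightarrow> coeff P (n - j) = 0"
    and zeros: "\<And>w. poly P w = 0 \<Longrightarrow> cmod w \<le> k"
  shows "real \<mu> * cmod (coeff P (n - \<mu>)) \<le> real n * x * k ^ \<mu>" (is ?coeff)
    and "cmod u = 1 \<Longrightarrow> real n * m \<le> cmod (poly (pderiv P) u)" (is "_ \<Longrightarrow> ?deriv")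
    and "cmod u = 1 \<Longrightarrow>
      (\<And>y. 0 < y \<Longrightarrow> x \<le> y \<Longrightarrow> real \<mu> * cmod (coeff P (n - \<mu>)) \<le> real n * y * k ^ \<mu> \<Longrightarrow>
        refined_radius n \<mu> k y (cmod (coeff P (n - \<mu>))) \<le> A) \<Longrightarrow>
      cmod (of_nat n * poly P u - u * poly (pderiv P) u) \<le> A * (cmod (poly (pderiv P) u) - real n * m)"
      (is "_ \<Longrightarrow> PROP _ \<Longrightarrow> ?bound")
proof -
  have n: "0 < n" "0 < degree P" using \<mu> by (simp_all add: n_def)
  have P: "P \<noteq> 0" using n by auto
  have m_ge: "0 \<le> m" using min_modulus_nonneg[of k P] k by (simp add: m_def)
  have m_le: "m \<le> cmod (lead_coeff P)"
    unfolding m_def by (rule min_modulus_le_lead_coeff[OF P k(1) zeros])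
  have x_eq: "x = cmod (lead_coeff P) - m" by (simp add: x_def m_def)
  define F where "F l = P + monom (l * of_real m) n" for l
  note F_facts = zeros_of_perturbed_lead_coeff[OF n(2) k(1), folded m_def, folded n_def, folded F_def]
  have F_deg: "degree (F l) = n" if "cmod l < 1" for l
    by (rule F_facts(1)[OF zeros that])
  have F_zeros: "cmod w \<le> k" if "cmod l < 1" "poly (F l) w = 0" for l w
    by (rule F_facts(2)[OF zeros that])
  have F_lead: "lead_coeff (F l) = lead_coeff P + l * of_real m" if "cmod l < 1" for l
    using F_facts(4)[OF zeros that] by (simp add: n_def)
  have F_deriv: "poly (pderiv (F l)) w = poly (pderiv P) w + l * of_real (real n * m) * w ^ (n - 1)"
    if "cmod l < 1" for l w
    by (rule F_facts(5)[OF zeros that])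
  have F_polar: "of_nat n * poly (F l) w - w * poly (pderiv (F l)) w = of_nat n * poly P w - w * poly (pderiv P) w"
    if "cmod l < 1" for l w
    by (rule F_facts(6)[OF zeros that])
  have coeff_F: "coeff (F l) (n - \<mu>) = coeff P (n - \<mu>)" if "cmod l < 1" for l
    by (rule F_facts(3)[OF zeros that]) (use \<mu> in auto)
  have F_gap: "coeff (F l) (n - j) = 0" if "cmod l < 1" "1 \<le> j" "j < \<mu>" for l j
  proof -
    have "coeff (F l) (n - j) = coeff P (n - j)"
      by (rule F_facts(3)[OF zeros that(1)]) (use that \<mu> in auto)
    then show ?thesis using gap[OF that(2,3)] by simp
  qed
  have F_coeff: "real \<mu> * cmod (coeff P (n - \<mu>)) \<le> real n * cmod (lead_coeff P + l * of_real m) * k ^ \<mu>"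
    if l: "cmod l < 1" for l
    using polar_part_le_refined(1)[of \<mu> "F l" k, unfolded F_lead[OF l], unfolded F_deg[OF l] coeff_F[OF l]]
      F_gap[OF l] F_zeros[OF l] \<mu> k by blast
  have F_bound: "cmod (of_nat n * poly P u - u * poly (pderiv P) u)
      \<le> refined_radius n \<mu> k (cmod (lead_coeff P + l * of_real m)) (cmod (coeff P (n - \<mu>)))
        * cmod (poly (pderiv P) u + l * of_real (real n * m) * u ^ (n - 1))"
    if l: "cmod l < 1" and u: "cmod u = 1" for l u
    using polar_part_le_refined(2)[of \<mu> "F l" k u,
        unfolded F_lead[OF l], unfolded F_deg[OF l] coeff_F[OF l] F_polar[OF l],
        unfolded F_deriv[OF l]]
      F_gap[OF l] F_zeros[OF l] \<mu> k u by blast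
  show ?coeff
  proof -
    let ?f = "\<lambda>s. real \<mu> * cmod (coeff P (n - \<mu>)) - real n * (cmod (lead_coeff P) - s * m) * k ^ \<mu>"
    have "?f 1 \<le> 0"
    proof (rule le_at_1_of_le_left[where f = ?f])
      show "continuous (at_left 1) ?f" by (intro continuous_intros)
      fix s :: real assume s: "0 < s" "s < 1"
      \<comment> \<open>The argument that shortens the leading coefficient as much as possible.\<close>
      define l where "l = - of_real s * sgn (lead_coeff P)"
      have l: "cmod l < 1" using s P by (simp add: l_def norm_mult norm_sgn)
      have "lead_coeff P + l * of_real m = sgn (lead_coeff P) * of_real (cmod (lead_coeff P) - s * m)"
        using P by (simp add: l_def sgn_eq field_simps)
      moreover have "s * m \<le> m" using s m_ge by (simp add: mult_left_le_one_le)
      ultimately have "cmod (lead_coeff P + l * of_real m) = cmod (lead_coeff P) - s * m"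
        using P m_le by (simp only: norm_mult norm_sgn norm_of_real) simp
      then show "?f s \<le> 0" using F_coeff[OF l] by simp
    qed
    then show ?thesis by (simp add: x_eq)
  qed
  show deriv: ?deriv if u: "cmod u = 1"
  proof (rule ccontr)
    assume less: "\<not> ?deriv"
    then have m: "0 < m" using m_ge n by (cases "m = 0") auto
    \<comment> \<open>This perturbation kills the derivative at \<open>u\<close>, which makes \<open>u\<close> a zero.\<close>
    define l where "l = - poly (pderiv P) u / (of_real (real n * m) * u ^ (n - 1))"
    have u0: "u \<noteq> 0" using u by auto
    have l: "cmod l < 1"
      using less m n u by (simp add: l_def norm_divide norm_mult norm_power)
    have "poly (pderiv (F l)) u = 0"
      using F_deriv[OF l, of u] m n u0 by (simp add: l_def)
    moreover from this have "cmod (of_nat n * poly (F l) u) \<le> 0"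
      using polar_part_le_deriv[of "F l" u] F_deg[OF l] F_zeros[OF l] k u by fastforce
    ultimately have "poly (F l) u = 0" using n by simp
    then have "poly P u = - (l * of_real m * u ^ n)"
      by (simp add: F_def poly_monom eq_neg_iff_add_eq_0)
    then have "cmod (poly P u) = cmod l * m"
      using m u by (simp add: norm_mult norm_power)
    also have "\<dots> < 1 * m" using l m by (intro mult_strict_right_mono)
    also have "1 * m \<le> cmod (poly P u)"
      using min_modulus_le_outside[OF P k(1) zeros, of u] k u by (simp add: m_def)
    finally show False by simp
  qed
  show ?bound if u: "cmod u = 1" and A:
      "\<And>y. 0 < y \<Longrightarrow> x \<le> y \<Longrightarrow> real \<mu> * cmod (coeff P (n - \<mu>)) \<le> real n * y * k ^ \<mu> \<Longrightarrow>
        refined_radius n \<mu> k y (cmod (coeff P (n - \<mu>))) \<le> A"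
  proof -
    let ?f = "\<lambda>s. cmod (of_nat n * poly P u - u * poly (pderiv P) u)
      - A * (cmod (poly (pderiv P) u) - s * (real n * m))"
    have "?f 1 \<le> 0"
    proof (rule le_at_1_of_le_left[where f = ?f])
      show "continuous (at_left 1) ?f" by (intro continuous_intros)
      fix s :: real assume s: "0 < s" "s < 1"
      \<comment> \<open>The argument that shortens the derivative at \<open>u\<close> as much as possible.\<close>
      define l where "l = - of_real s * sgn (poly (pderiv P) u) / u ^ (n - 1)"
      have u0: "u \<noteq> 0" using u by auto
      have l_le: "cmod l \<le> s" using s u by (simp add: l_def norm_mult norm_divide norm_power norm_sgn)
      then have l: "cmod l < 1" using s by simp
      have sm: "s * (real n * m) \<le> real n * m" using s m_ge by (simp add: mult_left_le_one_le)
      have l_deriv: "cmod (poly (pderiv P) u + l * of_real (real n * m) * u ^ (n - 1))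
          = cmod (poly (pderiv P) u) - s * (real n * m)"
      proof (cases "poly (pderiv P) u = 0")
        case True
        then have "m = 0" using deriv[OF u] n m_ge by (simp add: mult_le_0_iff)
        then show ?thesis using True by simp
      next
        case False
        then have "poly (pderiv P) u + l * of_real (real n * m) * u ^ (n - 1)
            = sgn (poly (pderiv P) u) * of_real (cmod (poly (pderiv P) u) - s * (real n * m))"
          using u0 by (simp add: l_def sgn_eq field_simps)
        then show ?thesis
          using False deriv[OF u] sm by (simp only: norm_mult norm_sgn norm_of_real) simp
      qed
      have "cmod l * m \<le> 1 * m" using l m_ge by (intro mult_right_mono) auto
      then have "x \<le> cmod (lead_coeff P) - cmod (l * of_real m)"
        using m_ge by (simp add: x_eq norm_mult)
      also have "\<dots> \<le> cmod (lead_coeff P + l * of_real m)"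
        by (rule norm_diff_ineq)
      finally have "x \<le> cmod (lead_coeff P + l * of_real m)" .
      moreover have "F l \<noteq> 0" using F_deg[OF l] n by auto
      then have "0 < cmod (lead_coeff P + l * of_real m)"
        unfolding F_lead[OF l, symmetric] by simp
      ultimately have "refined_radius n \<mu> k (cmod (lead_coeff P + l * of_real m)) (cmod (coeff P (n - \<mu>))) \<le> A"
        using F_coeff[OF l] by (intro A)
      then have "cmod (of_nat n * poly P u - u * poly (pderiv P) u)
          \<le> A * cmod (poly (pderiv P) u + l * of_real (real n * m) * u ^ (n - 1))"
        by (intro order_trans[OF F_bound[OF l u]] mult_right_mono) auto
      then show "?f s \<le> 0" unfolding l_deriv by simp
    qed
    then show ?thesis by simp
  qed
qed

section \<open>The lower bound for the polar derivative\<close>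

text \<open>
  The four summands on the right combine to
  \<open>n \<bar>\<alpha>\<bar> m' + (\<bar>\<alpha>\<bar> - A) n (M - m') / (1 + k\<^sup>\<mu>)\<close>, where \<open>m' = m / k\<^sup>n\<close>. In this form the inequality
  comes from the bound for \<open>n P - z P'\<close> at a point \<open>u\<close> of the unit circle where \<open>\<bar>P\<bar>\<close> is maximal.
\<close>

theorem theorem1p1:
  fixes n \<mu> :: nat and k :: real and P :: "complex poly" and \<alpha> :: complex
  assumes "1 \<le> \<mu>" and "\<mu> \<le> n"
    and "0 < k" and "k \<le> 1"
    and "degree P = n"
    and "\<And>j. 1 \<le> j \<Longrightarrow> j < \<mu> \<Longrightarrow> coeff P (n - j) = 0"
    and "\<And>z. poly P z = 0 \<Longrightarrow> cmod z \<le> k"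
    and "cmod \<alpha> \<ge> k ^ \<mu>"
  shows "max_modulus (polar_deriv \<alpha> P) 1 \<ge>
      real n * (cmod \<alpha> - k ^ \<mu>) / (1 + k ^ \<mu>) * max_modulus P 1
    + real n * (cmod \<alpha> + 1) / (k ^ (n - \<mu>) * (1 + k ^ \<mu>)) * min_modulus P k
    + real n * ((k ^ \<mu> - A_const P \<mu> k) / (1 + k ^ \<mu>)) * max_modulus P 1
    + real n * (A_const P \<mu> k - k ^ \<mu>) / (k ^ n * (1 + k ^ \<mu>)) * min_modulus P k"
proof -
  define m M A K a where "m = min_modulus P k / k ^ n" and "M = max_modulus P 1"
    and "A = A_const P \<mu> k" and "K = k ^ \<mu>" and "a = cmod \<alpha>"
  define x where "x = cmod (coeff P n) - m"
  have n: "0 < n" using assms(1,2) by simp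
  then have P: "P \<noteq> 0" using assms(5) by auto
  have K: "0 < K" using assms(3) by (simp add: K_def)
  have K_le: "K \<le> a" using assms(8) by (simp add: K_def a_def)
  obtain u where u: "cmod u = 1" and M_u: "cmod (poly P u) = M"
    using max_modulus_attained[of 1 P] by (auto simp: M_def)
  define p' S where "p' = cmod (poly (pderiv P) u)" and "S = cmod (of_nat n * poly P u - u * poly (pderiv P) u)"
  note refined = polar_part_le_refined_min[of \<mu> P k, unfolded assms(5), folded m_def, folded x_def,
      OF assms(1-4), folded K_def]
  have deriv: "real n * m \<le> p'" unfolding p'_def by (rule refined(2)) (use assms(6,7) u in auto)
  have m_le: "m \<le> cmod (coeff P n)"
    unfolding m_def using min_modulus_le_lead_coeff[OF P assms(3,7)] assms(5) by simp
  have "cmod (of_nat n * poly P u) \<le> S + cmod (u * poly (pderiv P) u)"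
    using norm_triangle_ineq[of "of_nat n * poly P u - u * poly (pderiv P) u" "u * poly (pderiv P) u"]
    by (simp add: S_def)
  then have nM: "real n * M \<le> S + p'" using u by (simp add: norm_mult M_u p'_def)
  have "a * p' - S \<le> cmod (poly (polar_deriv \<alpha> P) u)"
  proof -
    have "poly (polar_deriv \<alpha> P) u = \<alpha> * poly (pderiv P) u + (of_nat n * poly P u - u * poly (pderiv P) u)"
      by (simp add: poly_polar_deriv assms(5) algebra_simps)
    then show ?thesis
      using norm_diff_ineq[of "\<alpha> * poly (pderiv P) u"]
      by (simp add: a_def p'_def S_def norm_mult)
  qed
  also have "\<dots> \<le> max_modulus (polar_deriv \<alpha> P) 1"
    using max_modulus_attained[of 1 "polar_deriv \<alpha> P"] u by auto
  finally have polar: "a * p' - S \<le> max_modulus (polar_deriv \<alpha> P) 1" .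
  have main: "real n * (a * m) + (a - A) * (real n * (M - m)) / (1 + K) \<le> a * p' - S"
  proof (cases "0 < x")
    case True
    have A: "A = refined_radius n \<mu> k x (cmod (coeff P (n - \<mu>)))"
      by (simp add: A_def A_const_eq_refined_radius assms(5) x_def m_def)
    have "A \<le> K"
      unfolding A K_def by (intro refined_radius_le_power) (use refined(1) assms(1-4,6,7) n True in \<open>auto simp: K_def\<close>)
    have S_le: "S \<le> A * (p' - real n * m)"
      unfolding A S_def p'_def
      by (rule refined(3)) (use assms(1-4,6,7) u n True in \<open>auto intro: refined_radius_antimono\<close>)
    have "real n * (M - m) \<le> (1 + A) * (p' - real n * m)"
      using nM S_le by (simp add: algebra_simps)
    also have "\<dots> \<le> (1 + K) * (p' - real n * m)"
      using \<open>A \<le> K\<close> deriv by (intro mult_right_mono) auto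
    finally have "real n * (M - m) / (1 + K) \<le> p' - real n * m"
      using K by (simp add: pos_divide_le_eq mult.commute)
    then have "(a - A) * (real n * (M - m) / (1 + K)) \<le> (a - A) * (p' - real n * m)"
      using \<open>A \<le> K\<close> K_le by (intro mult_left_mono) auto
    then show ?thesis using S_le by (simp add: algebra_simps)
  next
    case False
    then have x: "cmod (coeff P n) = m" using m_le by (simp add: x_def)
    \<comment> \<open>Here \<open>P\<close> is a monomial, and the term containing \<open>A\<close> disappears.\<close>
    have "M = m"
      using min_modulus_eq_lead_coeff_imp[OF P assms(3,7), of u] x u assms(4,5) M_u by (simp add: m_def)
    have "S \<le> K * (p' - real n * m)"
      unfolding S_def p'_def K_def
      by (rule refined(3)[unfolded K_def])
        (use assms(1-4,6,7) u n in \<open>auto intro: refined_radius_le_power\<close>)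
    also have "\<dots> \<le> a * (p' - real n * m)"
      using K_le deriv by (intro mult_right_mono) auto
    finally show ?thesis using \<open>M = m\<close> by (simp add: algebra_simps)
  qed
  have "k ^ n = k ^ (n - \<mu>) * K"
    using assms(2) by (simp add: K_def flip: power_add)
  then have min_eq: "min_modulus P k = m * (k ^ (n - \<mu>) * K)" "k ^ n = k ^ (n - \<mu>) * K"
    using assms(3) by (auto simp: m_def)
  have "real n * (a - K) / (1 + K) * M + real n * (a + 1) / (k ^ (n - \<mu>) * (1 + K)) * min_modulus P k
      + real n * ((K - A) / (1 + K)) * M + real n * (A - K) / (k ^ n * (1 + K)) * min_modulus P k
    = real n * (a * m) + (a - A) * (real n * (M - m)) / (1 + K)"
  proof -
    define q N where "q = k ^ (n - \<mu>)" and "N = 1 + K"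
    have pos: "q > 0" "N > 0" using assms(3) K by (auto simp: q_def N_def)
    then have "real n * (a + 1) / (q * N) * (m * (q * K)) = real n * (a + 1) * m * K / N"
      and "real n * (A - K) / (q * K * N) * (m * (q * K)) = real n * (A - K) * m / N"
      using K by (simp_all add: field_simps)
    then show ?thesis
      unfolding min_eq q_def[symmetric] N_def[symmetric]
      using pos by (simp add: divide_simps) (simp add: N_def algebra_simps)
  qed
  with main polar show ?thesis
    unfolding M_def A_def K_def a_def by linarith
qed

end
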